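(* Let \(r\ge 1\) and let \(B=B_1\oplus B_2\oplus\cdots\oplus B_r\) be the \(3r\times 3r\) block diagonal matrix whose diagonal blocks \(B_1,\dots,B_r\) are \(3\times 3\) matrices whose entries are distinct variables (with all \(9r\) variables distinct), and whose off-diagonal blocks are zero. Suppose that \[ \operatorname{per}(B)=\sum_{i=1}^k c_i\det(S_i\circ B) \] as polynomials, where \(c_i\in\mathbb R\) and \(S_i\in\{\pm1\}^{3r\times 3r}\). Then \(k\ge (8/3)^r\).
   Context: \(\operatorname{per}\) denotes the permanent, \(\circ\) the entrywise (Hadamard) product, and \(B_1\oplus\cdots\oplus B_r\) the block diagonal matrix with the given diagonal blocks. *)

theory Defs
  imports
    Complex_Main
    "HOL-Library.Poly_Mapping"
    "Jordan_Normal_Form.Determinant"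
begin

text \<open>
  The polynomial ring over \<open>'a\<close> in the variables \<open>'v\<close>: a polynomial is a finitely supported map
  from monomials to coefficients, a monomial a finitely supported map from variables to exponents.
  The ring structure (convolution product) is the one of \<^theory>\<open>HOL-Library.Poly_Mapping\<close>.
\<close>

type_synonym ('v, 'a) mpoly = "('v \<Rightarrow>\<^sub>0 nat) \<Rightarrow>\<^sub>0 'a"

definition mpoly_const :: "'a::zero \<Rightarrow> ('v, 'a) mpoly" where
  "mpoly_const c = Poly_Mapping.single 0 c"

definition mpoly_var :: "'v \<Rightarrow> ('v, 'a::zero_neq_one) mpoly" where
  "mpoly_var v = Poly_Mapping.single (Poly_Mapping.single v 1) 1"

text \<open>The value \<open>0\<close> for non-square matrices is the convention of \<^const>\<open>det\<close>.\<close>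

definition per :: "'a::comm_ring_1 mat \<Rightarrow> 'a" where
  "per A = (if dim_row A = dim_col A
     then \<Sum>p \<in> {p. p permutes {0..<dim_row A}}. \<Prod>i = 0..<dim_row A. A $$ (i, p i)
     else 0)"

text \<open>Meaningful only if both matrices have the same dimensions.\<close>

definition hadamard :: "'a::times mat \<Rightarrow> 'a mat \<Rightarrow> 'a mat" (infixl "\<circ>\<^sub>H" 70) where
  "A \<circ>\<^sub>H B = mat (dim_row A) (dim_col A) (\<lambda>(i, j). A $$ (i, j) * B $$ (i, j))"

definition sign_mat :: "nat \<Rightarrow> real mat set" where
  "sign_mat n = {S \<in> carrier_mat n n. \<forall>i<n. \<forall>j<n. S $$ (i, j) \<in> {1, -1}}"

definition var_block :: "(nat \<Rightarrow> nat \<Rightarrow> 'v) \<Rightarrow> ('v, real) mpoly mat" where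
  "var_block y = mat 3 3 (\<lambda>(a, b). mpoly_var (y a b))"

text \<open>The \<open>3r \<times> 3r\<close> matrix whose \<open>t\<close>-th diagonal block has the variable \<open>x t a b\<close> in position \<open>(a, b)\<close>.\<close>

definition var_block_diag :: "nat \<Rightarrow> (nat \<Rightarrow> nat \<Rightarrow> nat \<Rightarrow> 'v) \<Rightarrow> ('v, real) mpoly mat" where
  "var_block_diag r x = diag_block_mat (map (\<lambda>t. var_block (x t)) [0..<r])"

end

theory Submission
  imports Defs
begin

text \<open>
  Let \<open>P\<close> be the set of the six permutations of \<open>{0, 1, 2}\<close>. Comparing the coefficients of the
  monomials given by permutations that preserve every block, the \<open>i\<close>-th summand contributes
  \<open>c\<^sub>i\<close> times a tensor \<open>v\<^sub>1 \<otimes> \<dots> \<otimes> v\<^sub>r\<close> with sign vectors \<open>v\<^sub>t\<close> indexed by \<open>P\<close>, and the sum of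
  these is the all-ones tensor. Every entry of a \<open>3 \<times> 3\<close> block occurs in two of the six
  monomials, and three permutations are odd, so the entries of each \<open>v\<^sub>t\<close> multiply to \<open>-1\<close>.

  Contract both sides with \<open>w\<^sub>1 \<otimes> \<dots> \<otimes> w\<^sub>r\<close>, where every \<open>w\<^sub>t\<close> is one of the 32 sign vectors with an
  even number of entries \<open>-1\<close>. The all-ones tensor contributes a nonzero number, as no \<open>w\<^sub>t\<close> has
  exactly three entries \<open>-1\<close>. On the other hand \<open>w\<^sub>t\<close> and \<open>v\<^sub>t\<close> are orthogonal unless their
  entrywise product, which has an odd number of entries \<open>-1\<close>, has one or five of them; this
  leaves 12 choices of \<open>w\<^sub>t\<close>. So each summand is nonzero for \<open>12\<^sup>r\<close> of the \<open>32\<^sup>r\<close> contractions only,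
  and some summand is nonzero for each of them.
\<close>

section \<open>Sign vectors on a six-element set, encoded as subsets\<close>

text \<open>Encoding a sign vector by its set of entries -1 turns entrywise products into symmetric
  differences and counting sign vectors into counting subsets.\<close>

definition sgn_on :: "'a set \<Rightarrow> 'a \<Rightarrow> real" where
  "sgn_on M s = (if s \<in> M then - 1 else 1)"

lemma sgn_on_mult: "sgn_on M s * sgn_on N s = sgn_on ((M - N) \<union> (N - M)) s"
  by (auto simp: sgn_on_def)

lemma sum_sgn_on:
  assumes "finite P" "M \<subseteq> P"
  shows "(\<Sum>s\<in>P. sgn_on M s) = real (card P) - 2 * real (card M)"
proof -
  have "(\<Sum>s\<in>P. sgn_on M s) = (\<Sum>s\<in>P. 1 - 2 * (if s \<in> M then 1 else 0))"
    by (intro sum.cong) (auto simp: sgn_on_def)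
  also have "\<dots> = real (card P) - 2 * (\<Sum>s\<in>P. if s \<in> M then 1 else 0)"
    by (simp add: sum_subtractf sum_distrib_left)
  also have "(\<Sum>s\<in>P. if s \<in> M then 1 else 0) = real (card M)"
    using assms by (simp add: sum.If_cases Int_absorb1)
  finally show ?thesis .
qed

lemma prod_sgn_on:
  assumes "finite P" "M \<subseteq> P"
  shows "(\<Prod>s\<in>P. sgn_on M s) = (- 1) ^ card M"
  using assms by (simp add: sgn_on_def prod.If_cases Int_absorb1)

text \<open>The parity of a set is recorded by the product of its signs, which is
  multiplicative.\<close>

lemma even_card_symdiff:
  assumes "finite P" "M \<subseteq> P" "N \<subseteq> P"
  shows "even (card ((M - N) \<union> (N - M))) \<longleftrightarrow> (even (card M) \<longleftrightarrow> even (card N))"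
proof -
  have "(- 1 :: real) ^ card ((M - N) \<union> (N - M)) = (- 1) ^ card M * (- 1) ^ card N"
    using assms by (subst (1 2 3) prod_sgn_on [of P, symmetric])
      (auto simp flip: prod.distrib sgn_on_mult)
  then show ?thesis
    by (simp add: uminus_power_if split: if_splits)
qed

lemma card_subsets_of_cards:
  assumes "finite P" "finite K"
  shows "card {M. M \<subseteq> P \<and> card M \<in> K} = (\<Sum>k\<in>K. card P choose k)"
proof -
  have "{M. M \<subseteq> P \<and> card M \<in> K} = (\<Union>k\<in>K. {M. M \<subseteq> P \<and> card M = k})"
    by auto
  also have "card \<dots> = (\<Sum>k\<in>K. card {M. M \<subseteq> P \<and> card M = k})"
    using assms by (intro card_UN_disjoint) auto
  finally show ?thesis
    using assms by (simp add: n_subsets)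
qed

lemma card_even_subsets:
  assumes "card P = 6"
  shows "card {M. M \<subseteq> P \<and> even (card M)} = 32"
proof -
  have fin: "finite P"
    using assms card.infinite by fastforce
  have "even n \<longleftrightarrow> n \<in> {0, 2, 4, 6}" if "n \<le> 6" for n :: nat
    using that by (auto; presburger)
  then have "{M. M \<subseteq> P \<and> even (card M)} = {M. M \<subseteq> P \<and> card M \<in> {0, 2, 4, 6}}"
    using card_mono [OF fin] assms by (metis (no_types, lifting))
  \<comment> \<open>The count is 1 + 15 + 15 + 1.\<close>
  also have "card \<dots> = 32"
    using card_subsets_of_cards [OF fin, of "{0, 2, 4, 6}"] assms
    by (simp add: eval_nat_numeral)
  finally show ?thesis .
qed

text \<open>Symmetric difference with \<open>N\<close> is an involution that flips parity, and the
  inner product is 6 minus twice the size of the result. It vanishes only at size 3, so the odd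
  sizes 1 and 5 remain, giving 6 + 6 sets.\<close>

lemma card_even_subsets_not_orthogonal:
  assumes P: "card P = 6" and N: "N \<subseteq> P" "odd (card N)"
  shows "card {M. M \<subseteq> P \<and> even (card M) \<and> (\<Sum>s\<in>P. sgn_on M s * sgn_on N s) \<noteq> 0} = 12"
proof -
  have fin: "finite P"
    using P card.infinite by fastforce
  define D where "D M = (M - N) \<union> (N - M)" for M
  have DD: "D (D M) = M" for M
    by (auto simp: D_def)
  have DP: "D M \<subseteq> P" if "M \<subseteq> P" for M
    using that N by (auto simp: D_def)
  have sum: "(\<Sum>s\<in>P. sgn_on M s * sgn_on N s) = 6 - 2 * real (card (D M))" if "M \<subseteq> P" for M
    using sum_sgn_on [OF fin DP [OF that]] P by (simp add: sgn_on_mult D_def)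
  have par: "even (card M) \<longleftrightarrow> odd (card (D M))" if "M \<subseteq> P" for M
    using even_card_symdiff [OF fin that N(1)] N(2) by (simp add: D_def)
  have odd: "odd n \<and> n \<noteq> 3 \<longleftrightarrow> n \<in> {1, 5}" if "n \<le> 6" for n :: nat
    using that by (auto; presburger)
  have iff: "even (card M) \<and> (\<Sum>s\<in>P. sgn_on M s * sgn_on N s) \<noteq> 0 \<longleftrightarrow> card (D M) \<in> {1, 5}"
    if "M \<subseteq> P" for M
    using sum [OF that] par [OF that] odd [of "card (D M)"] card_mono [OF fin DP [OF that]] P
    by auto
  have "{M. M \<subseteq> P \<and> even (card M) \<and> (\<Sum>s\<in>P. sgn_on M s * sgn_on N s) \<noteq> 0}
      = {M. M \<subseteq> P \<and> card (D M) \<in> {1, 5}}"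
    using iff by blast
  moreover have "bij_betw D {M. M \<subseteq> P \<and> card (D M) \<in> {1, 5}} {M. M \<subseteq> P \<and> card M \<in> {1, 5}}"
    by (rule bij_betw_byWitness [where f' = D]) (auto simp: DD dest: DP)
  ultimately have "card {M. M \<subseteq> P \<and> even (card M) \<and> (\<Sum>s\<in>P. sgn_on M s * sgn_on N s) \<noteq> 0}
      = card {M. M \<subseteq> P \<and> card M \<in> {1, 5}}"
    by (simp add: bij_betw_same_card)
  also have "\<dots> = 12"
    using card_subsets_of_cards [OF fin, of "{1, 5}"] P by (simp add: eval_nat_numeral)
  finally show ?thesis .
qed

section \<open>Counting rank-one terms by contractions\<close>

lemma tensor_decomposition_bound:
  fixes v :: "'i \<Rightarrow> 't \<Rightarrow> 'p \<Rightarrow> real" and c :: "'i \<Rightarrow> real"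
  assumes I: "finite I" and T: "finite T" and P: "card P = 6"
    and v: "\<And>i t s. i \<in> I \<Longrightarrow> t \<in> T \<Longrightarrow> s \<in> P \<Longrightarrow> v i t s \<in> {1, - 1}"
    and prod_v: "\<And>i t. i \<in> I \<Longrightarrow> t \<in> T \<Longrightarrow> (\<Prod>s\<in>P. v i t s) = - 1"
    and one: "\<And>\<sigma>. \<sigma> \<in> T \<rightarrow>\<^sub>E P \<Longrightarrow> (\<Sum>i\<in>I. c i * (\<Prod>t\<in>T. v i t (\<sigma> t))) = 1"
  shows "32 ^ card T \<le> card I * 12 ^ card T"
proof -
  have fin: "finite P"
    using P card.infinite by fastforce
  define W where "W = {M. M \<subseteq> P \<and> even (card M)}"
  define V where "V i t = {M \<in> W. (\<Sum>s\<in>P. sgn_on M s * v i t s) \<noteq> 0}" for i t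
  have finW: "finite W"
    using fin by (simp add: W_def)
  have cardV: "card (V i t) = 12" if it: "i \<in> I" "t \<in> T" for i t
  proof -
    define N where "N = {s \<in> P. v i t s = - 1}"
    have vN: "v i t s = sgn_on N s" if "s \<in> P" for s
      using v [OF it that] that by (auto simp: N_def sgn_on_def)
    have N: "N \<subseteq> P"
      by (auto simp: N_def)
    have "(- 1 :: real) ^ card N = - 1"
      using prod_v [OF it] vN prod_sgn_on [OF fin N] by simp
    then have "odd (card N)"
      by (auto simp: uminus_power_if split: if_splits)
    with card_even_subsets_not_orthogonal [OF P N] show ?thesis
      by (simp add: V_def W_def vN conj_assoc cong: sum.cong)
  qed
  have W0: "(\<Sum>s\<in>P. sgn_on M s) \<noteq> 0" if "M \<in> W" for M
  proof
    assume "(\<Sum>s\<in>P. sgn_on M s) = 0"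
    then have "card M = 3"
      using sum_sgn_on [OF fin, of M] that P by (simp add: W_def)
    with that show False
      by (simp add: W_def)
  qed
  \<comment> \<open>\<open>V i t\<close> holds the test vectors not orthogonal to the
    \<open>t\<close>-th factor of term \<open>i\<close>, so the claim is that every test tensor is
    detected by some term; the union bound then compares the counts.\<close>
  have "T \<rightarrow>\<^sub>E W \<subseteq> (\<Union>i\<in>I. \<Pi>\<^sub>E t\<in>T. V i t)"
  proof
    fix \<omega> assume \<omega>: "\<omega> \<in> T \<rightarrow>\<^sub>E W"
    let ?w = "\<lambda>\<sigma>. \<Prod>t\<in>T. sgn_on (\<omega> t) (\<sigma> t)"
    have "(\<Sum>i\<in>I. c i * (\<Prod>t\<in>T. \<Sum>s\<in>P. sgn_on (\<omega> t) s * v i t s))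
        = (\<Sum>i\<in>I. c i * (\<Sum>\<sigma>\<in>T \<rightarrow>\<^sub>E P. ?w \<sigma> * (\<Prod>t\<in>T. v i t (\<sigma> t))))"
      using T fin by (simp add: prod_sum_PiE prod.distrib)
    also have "\<dots> = (\<Sum>\<sigma>\<in>T \<rightarrow>\<^sub>E P. ?w \<sigma> * (\<Sum>i\<in>I. c i * (\<Prod>t\<in>T. v i t (\<sigma> t))))"
      by (simp add: sum_distrib_left mult.left_commute) (rule sum.swap)
    also have "\<dots> = (\<Sum>\<sigma>\<in>T \<rightarrow>\<^sub>E P. ?w \<sigma>)"
      by (intro sum.cong) (simp_all add: one)
    also have "\<dots> = (\<Prod>t\<in>T. \<Sum>s\<in>P. sgn_on (\<omega> t) s)"
      using T fin by (simp add: prod_sum_PiE)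
    also have "\<dots> \<noteq> 0"
      using T \<omega> W0 by (auto simp: PiE_iff)
    \<comment> \<open>A nonzero sum has a nonzero term, and a nonzero product has only nonzero
      factors.\<close>
    finally obtain i where "i \<in> I" "(\<Prod>t\<in>T. \<Sum>s\<in>P. sgn_on (\<omega> t) s * v i t s) \<noteq> 0"
      by (metis (no_types, lifting) mult_zero_right sum.neutral)
    with T \<omega> show "\<omega> \<in> (\<Union>i\<in>I. \<Pi>\<^sub>E t\<in>T. V i t)"
      by (auto simp: V_def PiE_iff)
  qed
  moreover have "finite (\<Union>i\<in>I. \<Pi>\<^sub>E t\<in>T. V i t)"
    using I T finW by (auto simp: V_def intro!: finite_PiE)
  ultimately have "card (T \<rightarrow>\<^sub>E W) \<le> card (\<Union>i\<in>I. \<Pi>\<^sub>E t\<in>T. V i t)"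
    by (rule card_mono [rotated])
  also have "\<dots> \<le> (\<Sum>i\<in>I. card (\<Pi>\<^sub>E t\<in>T. V i t))"
    using I by (rule card_UN_le)
  also have "\<dots> = card I * 12 ^ card T"
    using T by (simp add: card_PiE cardV)
  finally show ?thesis
    using T card_even_subsets [OF P] by (simp add: card_PiE W_def)
qed

section \<open>Permutations of three elements\<close>

text \<open>A permutation sending \<open>a\<close> to \<open>b\<close> is, in exactly one way, the
  transposition of \<open>a\<close> and \<open>b\<close> after a permutation fixing
  \<open>a\<close>. Iterating this makes products over all permutations of a small set
  explicit.\<close>

lemma prod_over_permutations_insert:
  assumes "finite S" "a \<notin> S"
  shows "(\<Prod>p | p permutes insert a S. f p)
    = (\<Prod>b\<in>insert a S. \<Prod>q | q permutes S. f (Transposition.transpose a b \<circ> q))"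
proof -
  let ?h = "\<lambda>(b, q). Transposition.transpose a b \<circ> q"
  have "inj_on ?h (insert a S \<times> {q. q permutes S})"
  proof (rule inj_onI, clarify)
    fix b c p q
    assume p: "p permutes S" and q: "q permutes S"
      and eq: "Transposition.transpose a b \<circ> p = Transposition.transpose a c \<circ> q"
    have "p a = a" "q a = a"
      using p q assms by (auto simp: permutes_not_in)
    then have bc: "b = c"
      using fun_cong [OF eq, of a] by simp
    have "p = q"
      using arg_cong [OF eq, of "(\<circ>) (Transposition.transpose a b)"] bc
      by (simp add: o_assoc)
    with bc show "b = c \<and> p = q" ..
  qed
  moreover have "{p. p permutes insert a S} = ?h ` (insert a S \<times> {q. q permutes S})"
    unfolding permutes_insert by (rule arg_cong [where f = "image ?h"]) auto
  ultimately show ?thesis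
    by (simp add: prod.reindex prod.cartesian_product case_prod_unfold)
qed

lemma prod_sign_times_prod_permutation:
  fixes a :: "nat \<Rightarrow> nat \<Rightarrow> real"
  assumes "\<And>i j. i < 3 \<Longrightarrow> j < 3 \<Longrightarrow> a i j \<in> {1, - 1}"
  shows "(\<Prod>p | p permutes {0..<3}. of_int (sign p) * (\<Prod>i<3. a i (p i))) = - 1"
proof -
  have eq: "{0..<3::nat} = insert 0 (insert 1 (insert 2 {}))"
    by auto
  \<comment> \<open>The set \<open>{2}\<close> admits only the identity, so the six permutations are
    products of two transpositions, trivial ones (\<open>b = 0\<close> or \<open>c = 1\<close>)
    included.\<close>
  have exp: "(\<Prod>p | p permutes {0..<3::nat}. f p) = (\<Prod>b\<in>{0,1,2}. \<Prod>c\<in>{1,2}.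
      f (Transposition.transpose 0 b \<circ> Transposition.transpose 1 c))" for f :: "(nat \<Rightarrow> nat) \<Rightarrow> real"
    unfolding eq by (simp add: prod_over_permutations_insert)
  \<comment> \<open>Within row \<open>i\<close>, each entry \<open>a i j\<close> is chosen by
    exactly two of the six permutations, so the product is the square of a sign.\<close>
  have "(\<Prod>p | p permutes {0..<3}. a i (p i)) = 1" if "i < 3" for i
  proof -
    have i: "i \<in> {0, 1, 2}"
      using that by auto
    have "a i 0 \<in> {1, - 1}" "a i 1 \<in> {1, - 1}" "a i 2 \<in> {1, - 1}"
      using assms that by auto
    with i show ?thesis
      unfolding exp by (auto simp: Transposition.transpose_def)
  qed
  moreover have "(\<Prod>p | p permutes {0..<3::nat}. real_of_int (sign p)) = - 1"
    unfolding exp by (simp add: sign_compose permutation_swap_id sign_swap_id)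
  ultimately show ?thesis
    by (simp add: prod.distrib prod.swap [of _ "{..<3}"])
qed

section \<open>Permutations acting blockwise\<close>

text \<open>Being the identity beyond \<open>n * r\<close> is what \<open>permutes\<close> demands
  for the set \<open>{0..<n * r}\<close>.\<close>

definition block_perm :: "nat \<Rightarrow> nat \<Rightarrow> (nat \<Rightarrow> nat \<Rightarrow> nat) \<Rightarrow> nat \<Rightarrow> nat" where
  "block_perm n r \<sigma> i = (if i < n * r then n * (i div n) + \<sigma> (i div n) (i mod n) else i)"

text \<open>Here \<open>map_permutation\<close> moves \<open>\<sigma> r\<close> to the last block
  and fixes all other indices, so the two factors act on disjoint sets. This factorization drives
  the induction on the number of blocks.\<close>

lemma block_perm_Suc:
  assumes "\<And>t. t < Suc r \<Longrightarrow> \<sigma> t permutes {0..<n}"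
  shows "block_perm n (Suc r) \<sigma>
    = block_perm n r \<sigma> \<circ> map_permutation {0..<n} (\<lambda>a. n * r + a) (\<sigma> r)"
proof
  fix i
  have inj: "inj_on (\<lambda>a. n * r + a) {0..<n}"
    by (auto simp: inj_on_def)
  consider "i < n * r" | "n * r \<le> i" "i < n * Suc r" | "n * Suc r \<le> i"
    by linarith
  then show "block_perm n (Suc r) \<sigma> i
    = (block_perm n r \<sigma> \<circ> map_permutation {0..<n} (\<lambda>a. n * r + a) (\<sigma> r)) i"
  proof cases
    case 1
    then show ?thesis
      by (auto simp: block_perm_def map_permutation_def restrict_id_def)
  next
    case 2
    then obtain a where a: "i = n * r + a" "a < n"
      by (auto simp: le_iff_add)
    then have "\<sigma> r a < n"
      using assms [of r] permutes_in_image [of "\<sigma> r" "{0..<n}" a] by auto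
    with a show ?thesis
      using map_permutation_apply [OF inj, of a "\<sigma> r"] by (simp add: block_perm_def)
  next
    case 3
    then show ?thesis
      by (auto simp: block_perm_def map_permutation_def restrict_id_def)
  qed
qed

text \<open>Transporting a permutation along an injection keeps its sign, so adding the last block
  multiplies the sign by that of \<open>\<sigma> r\<close>.\<close>

lemma
  assumes "\<And>t. t < r \<Longrightarrow> \<sigma> t permutes {0..<n}"
  shows block_perm_permutes: "block_perm n r \<sigma> permutes {0..<n * r}"
    and sign_block_perm: "sign (block_perm n r \<sigma>) = (\<Prod>t<r. sign (\<sigma> t))"
proof -
  have "block_perm n r \<sigma> permutes {0..<n * r} \<and> sign (block_perm n r \<sigma>) = (\<Prod>t<r. sign (\<sigma> t))"
    using assms
  proof (induction r)
    case 0
    have "block_perm n 0 \<sigma> = id"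
      by (rule ext) (simp add: block_perm_def)
    then show ?case
      by (simp add: id_def)
  next
    case (Suc r)
    let ?m = "map_permutation {0..<n} (\<lambda>a. n * r + a) (\<sigma> r)"
    have inj: "inj_on (\<lambda>a. n * r + a) {0..<n}"
      by (auto simp: inj_on_def)
    have \<sigma>r: "\<sigma> r permutes {0..<n}"
      using Suc.prems by simp
    have "?m permutes (\<lambda>a. n * r + a) ` {0..<n}"
      using inj \<sigma>r by (intro map_permutation_permutes) (simp_all add: bij_betw_def)
    then have m: "?m permutes {0..<n * Suc r}"
      by (rule permutes_subset) auto
    have IH: "block_perm n r \<sigma> permutes {0..<n * r}"
      "sign (block_perm n r \<sigma>) = (\<Prod>t<r. sign (\<sigma> t))"
      using Suc by auto
    from IH(1) have b: "block_perm n r \<sigma> permutes {0..<n * Suc r}"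
      by (rule permutes_subset) auto
    have "sign (block_perm n r \<sigma> \<circ> ?m) = sign (block_perm n r \<sigma>) * sign ?m"
      using b m by (intro sign_compose) (auto intro: permutation_permutes [THEN iffD2])
    moreover have "sign ?m = sign (\<sigma> r)"
      using inj \<sigma>r by (intro sign_map_permutation) auto
    moreover have "block_perm n (Suc r) \<sigma> = block_perm n r \<sigma> \<circ> ?m"
      using Suc.prems by (rule block_perm_Suc)
    ultimately show ?case
      using permutes_compose [OF m b] IH(2) by (simp del: mult_Suc_right o_apply)
  qed
  then show "block_perm n r \<sigma> permutes {0..<n * r}" "sign (block_perm n r \<sigma>) = (\<Prod>t<r. sign (\<sigma> t))"
    by auto
qed

lemma prod_block_perm:
  fixes f :: "nat \<Rightarrow> nat \<Rightarrow> 'a::comm_monoid_mult"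
  shows "(\<Prod>i = 0..<n * r. f i (block_perm n r \<sigma> i)) = (\<Prod>t<r. \<Prod>a<n. f (n * t + a) (n * t + \<sigma> t a))"
proof -
  have "(\<Prod>i = 0..<n * r. g i) = (\<Prod>t<r. \<Prod>a<n. g (n * t + a))" for g :: "nat \<Rightarrow> 'a"
  proof (induction r)
    case (Suc r)
    have "(\<Prod>i = 0..<n * Suc r. g i) = (\<Prod>i = 0..<n * r. g i) * (\<Prod>i = n * r..<n * r + n. g i)"
      by (simp add: prod.atLeastLessThan_concat add.commute)
    also have "(\<Prod>i = n * r..<n * r + n. g i) = (\<Prod>a<n. g (n * r + a))"
      using prod.shift_bounds_nat_ivl [of g 0 "n * r" n]
      by (simp add: add.commute lessThan_atLeast0)
    finally show ?case
      by (simp add: Suc)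
  qed simp
  also have "(\<Prod>t<r. \<Prod>a<n. f (n * t + a) (block_perm n r \<sigma> (n * t + a)))
      = (\<Prod>t<r. \<Prod>a<n. f (n * t + a) (n * t + \<sigma> t a))"
  proof (intro prod.cong refl)
    fix t a assume "t \<in> {..<r}" "a \<in> {..<n}"
    then have "n * t + a < n * Suc t" "n * Suc t \<le> n * r"
      by (auto simp del: mult_Suc_right intro: mult_le_mono) simp
    then have "n * t + a < n * r"
      by linarith
    with \<open>a \<in> {..<n}\<close> show "f (n * t + a) (block_perm n r \<sigma> (n * t + a)) = f (n * t + a) (n * t + \<sigma> t a)"
      by (simp add: block_perm_def)
  qed
  finally show ?thesis .
qed

section \<open>Entries of block diagonal matrices\<close>

lemma diag_block_mat_carrier:
  assumes "\<And>A. A \<in> set As \<Longrightarrow> A \<in> carrier_mat n n"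
  shows "diag_block_mat As \<in> carrier_mat (n * length As) (n * length As)"
proof -
  have "map dim_row As = map (\<lambda>_. n) As" "map dim_col As = map (\<lambda>_. n) As"
    using assms by (auto intro!: map_cong)
  then show ?thesis
    by (intro carrier_matI) (simp_all only: dim_diag_block_mat sum_list_triv, simp_all)
qed

lemma index_diag_block_mat:
  assumes "\<And>A. A \<in> set As \<Longrightarrow> A \<in> carrier_mat n n"
    and "i < n * length As" "j < n * length As"
  shows "diag_block_mat As $$ (i, j)
    = (if i div n = j div n then (As ! (i div n)) $$ (i mod n, j mod n) else 0)"
  using assms
proof (induction As arbitrary: i j)
  case (Cons A As)
  have A: "A \<in> carrier_mat n n" and D: "diag_block_mat As \<in> carrier_mat (n * length As) (n * length As)"
    using Cons.prems by (auto intro: diag_block_mat_carrier)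
  have n: "n > 0"
    using Cons.prems(2) by (cases n) auto
  \<comment> \<open>Removing the first block lowers the block number by one and keeps the position
    inside the block.\<close>
  have shift: "k div n = Suc ((k - n) div n)" "k mod n = (k - n) mod n" if "\<not> k < n" for k
    using that n by (auto simp: le_div_geq le_mod_geq)
  show ?case
    using Cons.prems A D Cons.IH [of "i - n" "j - n"]
    by (cases "i < n"; cases "j < n")
      (auto simp: Let_def shift index_mat_four_block(1) carrier_matD [OF A] carrier_matD [OF D])
qed auto

section \<open>Coefficients of permanents and determinants\<close>

lemma prod_single:
  "(\<Prod>i\<in>I. Poly_Mapping.single (e i) (b i) :: ('v, 'a::comm_semiring_1) mpoly)
    = Poly_Mapping.single (\<Sum>i\<in>I. e i) (\<Prod>i\<in>I. b i)"
  by (induction I rule: infinite_finite_induct) (simp_all add: mult_single)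

lemma lookup_mpoly_const_mult:
  "Poly_Mapping.lookup (mpoly_const c * f) m = c * Poly_Mapping.lookup f m"
  for f :: "('v, real) mpoly"
  unfolding mpoly_const_def mult_map_scale_conv_mult [symmetric]
  by (simp add: Poly_Mapping.map.rep_eq when_def)

text \<open>The weight \<open>\<chi>\<close> lets one statement serve permanents and determinants.
  Uniqueness is demanded only where the product of coefficients is nonzero, because zero entries
  still carry a formal monomial.\<close>

lemma lookup_permutation_sum:
  fixes e :: "nat \<Rightarrow> nat \<Rightarrow> 'v \<Rightarrow>\<^sub>0 nat" and b :: "nat \<Rightarrow> nat \<Rightarrow> real"
  assumes q: "q permutes U" and U: "finite U"
    and uniq: "\<And>p. p permutes U \<Longrightarrow> (\<Prod>i\<in>U. b i (p i)) \<noteq> 0 \<Longrightarrow>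
      (\<Sum>i\<in>U. e i (p i)) = (\<Sum>i\<in>U. e i (q i)) \<Longrightarrow> p = q"
  shows "Poly_Mapping.lookup
      (\<Sum>p | p permutes U. of_int (\<chi> p) * (\<Prod>i\<in>U. Poly_Mapping.single (e i (p i)) (b i (p i))))
      (\<Sum>i\<in>U. e i (q i))
    = of_int (\<chi> q) * (\<Prod>i\<in>U. b i (q i))"
proof -
  have coeff: "Poly_Mapping.lookup
      (of_int (\<chi> p) * (\<Prod>i\<in>U. Poly_Mapping.single (e i (p i)) (b i (p i)))) (\<Sum>i\<in>U. e i (q i))
    = (of_int (\<chi> p) * (\<Prod>i\<in>U. b i (p i)) when (\<Sum>i\<in>U. e i (p i)) = (\<Sum>i\<in>U. e i (q i)))" for p
    by (simp add: prod_single mult_single lookup_single flip: single_of_int)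
  have "(\<Sum>p | p permutes U. of_int (\<chi> p) * (\<Prod>i\<in>U. b i (p i))
        when (\<Sum>i\<in>U. e i (p i)) = (\<Sum>i\<in>U. e i (q i)))
      = (\<Sum>p | p permutes U. if p = q then of_int (\<chi> q) * (\<Prod>i\<in>U. b i (q i)) else 0)"
    using uniq by (intro sum.cong) (auto simp: when_def)
  with q U show ?thesis
    by (simp add: lookup_sum coeff finite_permutations)
qed

text \<open>A zero outside the diagonal blocks is written as a monomial with coefficient 0, its
  exponent a mere placeholder, so that all entries have the same form.\<close>

lemma index_var_block_diag:
  assumes "i < 3 * r" "j < 3 * r"
  shows "var_block_diag r x $$ (i, j)
    = Poly_Mapping.single (Poly_Mapping.single (x (i div 3) (i mod 3) (j mod 3)) 1)
        (if i div 3 = j div 3 then 1 else 0)"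
  using assms unfolding var_block_diag_def
  by (subst index_diag_block_mat [where n = 3])
    (auto simp: var_block_def mpoly_var_def less_mult_imp_div_less mult.commute)

lemma var_block_diag_carrier: "var_block_diag r x \<in> carrier_mat (3 * r) (3 * r)"
proof -
  have "A \<in> carrier_mat 3 3" if "A \<in> set (map (\<lambda>t. var_block (x t)) [0..<r])" for A
    using that by (auto simp: var_block_def)
  then show ?thesis
    using diag_block_mat_carrier [of "map (\<lambda>t. var_block (x t)) [0..<r]" 3]
    by (simp add: var_block_diag_def)
qed

text \<open>By distinctness, a variable reveals its row and its column within the block, while the
  block of \<open>p i\<close> is that of \<open>i\<close>; hence the monomial determines the
  permutation.\<close>

lemma block_monomial_inj:
  fixes x :: "nat \<Rightarrow> nat \<Rightarrow> nat \<Rightarrow> 'v" and r :: nat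
  defines "e \<equiv> \<lambda>i j. Poly_Mapping.single (x (i div 3) (i mod 3) (j mod 3)) (1 :: nat)"
  assumes inj: "inj_on (\<lambda>(t, a, b). x t a b) ({0..<r} \<times> {0..<3} \<times> {0..<3})"
    and p: "p permutes {0..<3 * r}" "\<And>i. i < 3 * r \<Longrightarrow> p i div 3 = i div 3"
    and q: "q permutes {0..<3 * r}" "\<And>i. i < 3 * r \<Longrightarrow> q i div 3 = i div 3"
    and eq: "(\<Sum>i\<in>{0..<3 * r}. e i (p i)) = (\<Sum>i\<in>{0..<3 * r}. e i (q i))"
  shows "p = q"
proof
  fix i
  show "p i = q i"
  proof (cases "i < 3 * r")
    case True
    \<comment> \<open>The variable that \<open>p\<close> selects in row \<open>i\<close> must occur
      in the monomial of \<open>q\<close>; distinctness forces the row \<open>k\<close> where it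
      occurs to be \<open>i\<close>.\<close>
    let ?v = "x (i div 3) (i mod 3) (p i mod 3)"
    have "0 < Poly_Mapping.lookup (e i (p i)) ?v"
      by (simp add: e_def)
    also have "\<dots> \<le> (\<Sum>k\<in>{0..<3 * r}. Poly_Mapping.lookup (e k (p k)) ?v)"
      using True by (intro member_le_sum) auto
    also have "\<dots> = (\<Sum>k\<in>{0..<3 * r}. Poly_Mapping.lookup (e k (q k)) ?v)"
      using arg_cong [OF eq, of "\<lambda>f. Poly_Mapping.lookup f ?v"] by (simp add: lookup_sum)
    finally have "(\<Sum>k\<in>{0..<3 * r}. Poly_Mapping.lookup (e k (q k)) ?v) \<noteq> 0"
      by (rule gr_implies_not0)
    then obtain k where k: "k < 3 * r" "Poly_Mapping.lookup (e k (q k)) ?v \<noteq> 0"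
      by (rule sum.not_neutral_contains_not_neutral) auto
    then have "x (k div 3) (k mod 3) (q k mod 3) = ?v"
      by (auto simp: e_def lookup_single when_def split: if_splits)
    moreover have "i div 3 < r" "k div 3 < r"
      using True k by auto
    ultimately have "k div 3 = i div 3" "k mod 3 = i mod 3" "q k mod 3 = p i mod 3"
      using inj_onD [OF inj, of "(k div 3, k mod 3, q k mod 3)" "(i div 3, i mod 3, p i mod 3)"]
      by auto
    then show ?thesis
      using p(2) [OF True] q(2) [OF True] by (metis div_mult_mod_eq)
  next
    case False
    then show ?thesis
      using p(1) q(1) by (simp add: permutes_not_in)
  qed
qed

text \<open>Both sides are compared at the monomial of \<open>q\<close>. No other permutation
  contributes to it, so the permanent yields 1 and each determinant a single signed product of
  entries of \<open>S i\<close>.\<close>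

lemma coefficient_equation:
  fixes x :: "nat \<Rightarrow> nat \<Rightarrow> nat \<Rightarrow> 'v"
  assumes inj: "inj_on (\<lambda>(t, a, b). x t a b) ({0..<r} \<times> {0..<3} \<times> {0..<3})"
    and S: "\<And>i. i \<in> I \<Longrightarrow> S i \<in> carrier_mat (3 * r) (3 * r)"
    and eq: "per (var_block_diag r x)
      = (\<Sum>i\<in>I. mpoly_const (c i) * det (map_mat mpoly_const (S i) \<circ>\<^sub>H var_block_diag r x))"
    and q: "q permutes {0..<3 * r}" "\<And>i. i < 3 * r \<Longrightarrow> q i div 3 = i div 3"
  shows "(\<Sum>i\<in>I. c i * (of_int (sign q) * (\<Prod>j = 0..<3 * r. S i $$ (j, q j)))) = (1 :: real)"
proof -
  let ?U = "{0..<3 * r}"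
  define e where "e i j = Poly_Mapping.single (x (i div 3) (i mod 3) (j mod 3)) (1 :: nat)" for i j
  define d where "d i j = (if i div 3 = j div 3 then 1 else 0 :: real)" for i j :: nat
  let ?m = "\<Sum>i\<in>?U. e i (q i)"
  let ?B = "var_block_diag r x"
  have dimB: "dim_row ?B = 3 * r" "dim_col ?B = 3 * r"
    using var_block_diag_carrier [of r x] by auto
  have B: "?B $$ (i, p i) = Poly_Mapping.single (e i (p i)) (d i (p i))"
    if "i \<in> ?U" "p permutes ?U" for i p
    using that permutes_in_image [OF that(2), of i] by (simp add: index_var_block_diag e_def d_def)
  \<comment> \<open>Here \<open>a\<close> is an arbitrary array of scalars, later all ones or the
    entries of \<open>S i\<close>. A nonzero product forces \<open>d i (p i)\<close> to be nonzero
    in each row, so \<open>p\<close> preserves the blocks.\<close>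
  have uniq: "p = q" if p: "p permutes ?U" and nz: "(\<Prod>i\<in>?U. a i (p i) * d i (p i)) \<noteq> 0"
    and "(\<Sum>i\<in>?U. e i (p i)) = ?m" for p a
  proof (rule block_monomial_inj [OF inj p _ q])
    show "p i div 3 = i div 3" if "i < 3 * r" for i
    proof -
      have "d i (p i) \<noteq> 0"
        using nz that by (auto simp: prod_zero_iff)
      then show ?thesis
        by (simp add: d_def split: if_splits)
    qed
  qed (use that in \<open>simp_all add: e_def\<close>)
  have coeff: "Poly_Mapping.lookup (\<Sum>p | p permutes ?U. of_int (\<chi> p) *
      (\<Prod>i\<in>?U. Poly_Mapping.single (e i (p i)) (a i (p i) * d i (p i)))) ?m
    = of_int (\<chi> q) * (\<Prod>i\<in>?U. a i (q i))" for \<chi> a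
  proof -
    have "(\<Prod>i\<in>?U. a i (q i) * d i (q i)) = (\<Prod>i\<in>?U. a i (q i))"
      using q(2) by (intro prod.cong) (auto simp: d_def)
    then show ?thesis
      by (subst lookup_permutation_sum [OF q(1), of "\<lambda>i j. a i j * d i j" e \<chi>]) (use uniq in auto)
  qed
  have "per ?B = (\<Sum>p | p permutes ?U. of_int 1 *
      (\<Prod>i\<in>?U. Poly_Mapping.single (e i (p i)) (1 * d i (p i))))"
    unfolding per_def dimB by (simp add: B)
  then have per: "Poly_Mapping.lookup (per ?B) ?m = 1"
    using coeff [of "\<lambda>_. 1" "\<lambda>_ _. 1"] by simp
  have det: "Poly_Mapping.lookup (det (map_mat mpoly_const (S i) \<circ>\<^sub>H ?B)) ?m
      = of_int (sign q) * (\<Prod>j\<in>?U. S i $$ (j, q j))" if "i \<in> I" for i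
  proof -
    have "(map_mat mpoly_const (S i) \<circ>\<^sub>H ?B) $$ (j, p j)
        = Poly_Mapping.single (e j (p j)) (S i $$ (j, p j) * d j (p j))"
      if "j \<in> ?U" "p permutes ?U" for j p
      using that S [OF \<open>i \<in> I\<close>] permutes_in_image [OF that(2), of j]
      by (simp add: hadamard_def B mpoly_const_def mult_single)
    then have "det (map_mat mpoly_const (S i) \<circ>\<^sub>H ?B) = (\<Sum>p | p permutes ?U. of_int (sign p) *
      (\<Prod>j\<in>?U. Poly_Mapping.single (e j (p j)) (S i $$ (j, p j) * d j (p j))))"
      using S [OF \<open>i \<in> I\<close>] by (subst det_def' [of _ "3 * r"]) (auto simp: hadamard_def intro!: sum.cong)
    then show ?thesis
      using coeff [of sign "\<lambda>i' j. S i $$ (i', j)"] by simp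
  qed
  show ?thesis
    using arg_cong [OF eq, of "\<lambda>f. Poly_Mapping.lookup f ?m"]
    by (simp add: per det lookup_sum lookup_mpoly_const_mult)
qed

section \<open>From the determinant identity to the tensor bound\<close>

theorem theorem3p4:
  fixes r k :: nat
    and x :: "nat \<Rightarrow> nat \<Rightarrow> nat \<Rightarrow> 'v"
    and B :: "('v, real) mpoly mat"
    and c :: "nat \<Rightarrow> real"
    and S :: "nat \<Rightarrow> real mat"
  assumes "r \<ge> 1"
    and "inj_on (\<lambda>(t, a, b). x t a b) ({0..<r} \<times> {0..<3} \<times> {0..<3})"
    and "B = var_block_diag r x"
    and "\<And>i. i \<in> {1..k} \<Longrightarrow> S i \<in> sign_mat (3 * r)"
    and "per B = (\<Sum>i = 1..k. mpoly_const (c i) * det (map_mat mpoly_const (S i) \<circ>\<^sub>H B))"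
  shows "real k \<ge> (8 / 3) ^ r"
proof -
  define P where "P = {p. p permutes {0..<3::nat}}"
  \<comment> \<open>The sign of \<open>p\<close> can be absorbed into \<open>v\<close> because the
    sign of a block permutation is the product of the signs on its blocks.\<close>
  define v where "v i t p = of_int (sign p) * (\<Prod>a<3. S i $$ (3 * t + a, 3 * t + p a))" for i t p
  have idx: "3 * t + a < 3 * r" if "t < r" "a < 3" for t a
    using that by linarith
  have S_entry: "S i $$ (3 * t + a, 3 * t + b) \<in> {1, - 1}"
    if "i \<in> {1..k}" "t < r" "a < 3" "b < 3" for i t a b
    using assms(4) [OF that(1)] idx that unfolding sign_mat_def by blast
  have P: "card P = 6"
    by (simp add: P_def card_permutations [of _ 3] eval_nat_numeral)
  have v: "v i t p \<in> {1, - 1}" if "i \<in> {1..k}" "t \<in> {..<r}" "p \<in> P" for i t p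
  proof -
    have "\<bar>S i $$ (3 * t + a, 3 * t + p a)\<bar> = 1" if "a < 3" for a
    proof -
      have "p a < 3"
        using \<open>p \<in> P\<close> \<open>a < 3\<close> permutes_in_image [of p "{0..<3}" a] by (simp add: P_def)
      then show ?thesis
        using S_entry [OF \<open>i \<in> _\<close> _ \<open>a < 3\<close>] \<open>t \<in> _\<close> by fastforce
    qed
    then have "\<bar>v i t p\<bar> = 1"
      by (simp add: v_def abs_mult abs_prod sign_def)
    then show ?thesis
      by (auto simp: abs_if split: if_splits)
  qed
  have prod_v: "(\<Prod>p\<in>P. v i t p) = - 1" if "i \<in> {1..k}" "t \<in> {..<r}" for i t
    unfolding P_def v_def
    by (rule prod_sign_times_prod_permutation) (use S_entry that in auto)
  have one: "(\<Sum>i\<in>{1..k}. c i * (\<Prod>t\<in>{..<r}. v i t (\<sigma> t))) = 1" if "\<sigma> \<in> {..<r} \<rightarrow>\<^sub>E P" for \<sigma>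
  proof -
    \<comment> \<open>The monomial of this permutation addresses the tensor entry at
      \<open>\<sigma>\<close>.\<close>
    let ?q = "block_perm 3 r \<sigma>"
    have \<sigma>: "\<sigma> t permutes {0..<3}" if "t < r" for t
      using \<open>\<sigma> \<in> _\<close> that by (auto simp: P_def PiE_iff)
    have "?q i div 3 = i div 3" if "i < 3 * r" for i
    proof -
      have "i div 3 < r"
        using that by auto
      then have "\<sigma> (i div 3) (i mod 3) < 3"
        using permutes_in_image [OF \<sigma>, of "i div 3" "i mod 3"] by simp
      with that show ?thesis
        by (simp add: block_perm_def)
    qed
    moreover have "of_int (sign ?q) * (\<Prod>j = 0..<3 * r. S i $$ (j, ?q j)) = (\<Prod>t<r. v i t (\<sigma> t))" for i
      using sign_block_perm [of r \<sigma> 3] \<sigma> prod_block_perm [of "\<lambda>j l. S i $$ (j, l)" 3 r \<sigma>]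
      by (simp add: v_def prod.distrib)
    ultimately show ?thesis
      using coefficient_equation [OF assms(2) _ assms(5) [unfolded assms(3)]
          block_perm_permutes [of r \<sigma> 3, OF \<sigma>]] assms(4)
      by (simp add: sign_mat_def)
  qed
  have "32 ^ r \<le> k * 12 ^ r"
    using tensor_decomposition_bound [where I = "{1..k}" and T = "{..<r}", OF _ _ P v prod_v one]
    by simp
  then have "real (32 ^ r) \<le> real (k * 12 ^ r)"
    by (rule of_nat_mono)
  \<comment> \<open>The base 8/3 is 32/12: all test vectors over those not orthogonal to a given
    factor.\<close>
  moreover have "(8 / 3 :: real) ^ r * 12 ^ r = 32 ^ r"
    by (simp flip: power_mult_distrib)
  ultimately have "(8 / 3) ^ r * 12 ^ r \<le> real k * 12 ^ r"
    by simp
  then show ?thesis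
    by (rule mult_right_le_imp_le) simp
qed

end
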